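(* Let $\{(X_i,* )\}_{i=1}^m$ be a family of based (normal) spaces and let $K$ be a simplicial complex with vertex set $[m]=\{1,\ldots,m\}$. If the family is LS-logarithmic, meaning that $$\mathrm{cat}(X_{i_1}\times\cdots\times X_{i_k})=\mathrm{cat}(X_{i_1})+\cdots+\mathrm{cat}(X_{i_k})$$ for any subcollection $X_{i_1},\ldots,X_{i_k}$ with $i_r\ne i_s$ for $r\neq s$, then $$\mathrm{cat}(\underline{X}^K)=\max_{\sigma=[i_1,\ldots,i_n]}\left\{\mathrm{cat}(X_{i_1})+\cdots+\mathrm{cat}(X_{i_n})\right\},$$ where the maximum is taken over all simplices $\sigma$ of $K$.
   Context: All spaces are assumed to be normal. The Lusternik–Schnirelmann category $\mathrm{cat}(X)$ (normalized, so that contractible spaces have category $0$) is the smallest $n$ such that $X$ is covered by $n+1$ open sets each of which is contractible to a point in $X$; equivalently, it is the sectional category of the fibration $PX\to X$ from the space of based paths, taking a path to its endpoint. The polyhedral product $\underline{X}^K$ is the subspace $\bigcup_{\sigma\in K}X^\sigma$ of $\prod_{i=1}^m X_i$, where $X^\sigma=\prod_{i=1}^m Y_i$ with $Y_i=X_i$ if $i\in\sigma$ and $Y_i=\{*\}$ if $i\notin\sigma$.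
   Formalization: The spaces X_i are additionally assumed path-connected with nondegenerate (NDR) base points; otherwise the claim fails, e.g. for two cones over the Hawaiian earring based at the bad point, with K two isolated vertices. *)

theory Defs
  imports "HOL-Analysis.Analysis" "HOL-Library.Extended_Nat"
begin

definition contractible_in :: "'a topology \<Rightarrow> 'a set \<Rightarrow> bool" where
  "contractible_in X U \<longleftrightarrow>
     U \<subseteq> topspace X \<and>
     (\<exists>a\<in>topspace X. homotopic_with (\<lambda>_. True) (subtopology X U) X id (\<lambda>_. a))"

text \<open>The normalized Lusternik--Schnirelmann category. It is \<open>\<infinity>\<close> (the infimum of the
  empty set) if no finite cover of the required kind exists.\<close>

definition lscat :: "'a topology \<Rightarrow> enat" where
  "lscat X = Inf {enat n | n.
     \<exists>U :: nat \<Rightarrow> 'a set. (\<forall>k\<le>n. openin X (U k) \<and> contractible_in X (U k)) \<and>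
       (\<Union>k\<le>n. U k) = topspace X}"

text \<open>A nondegenerate base point, i.e. \<open>(X, {a})\<close> is an NDR pair; equivalently,
  the inclusion of \<open>{a}\<close> is a closed cofibration.\<close>

definition nondegenerate_point :: "'a topology \<Rightarrow> 'a \<Rightarrow> bool" where
  "nondegenerate_point X a \<longleftrightarrow>
     a \<in> topspace X \<and>
     (\<exists>(u :: 'a \<Rightarrow> real) (h :: real \<times> 'a \<Rightarrow> 'a).
        continuous_map X (top_of_set {0..1}) u \<and>
        {x \<in> topspace X. u x = 0} = {a} \<and>
        continuous_map (prod_topology (top_of_set {0..1}) X) X h \<and>
        (\<forall>x\<in>topspace X. h (0, x) = x) \<and>
        (\<forall>t\<in>{0..1}. h (t, a) = a) \<and>
        (\<forall>x\<in>topspace X. u x < 1 \<longrightarrow> h (1, x) = a))"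

text \<open>The empty simplex belongs to every complex, and every element of the vertex set
  is a vertex of the complex (there are no ghost vertices).\<close>

definition simplicial_complex_on :: "'i set \<Rightarrow> 'i set set \<Rightarrow> bool" where
  "simplicial_complex_on V K \<longleftrightarrow>
     {} \<in> K \<and>
     (\<forall>\<sigma>\<in>K. finite \<sigma> \<and> \<sigma> \<subseteq> V) \<and>
     (\<forall>\<sigma>\<in>K. \<forall>\<tau>. \<tau> \<subseteq> \<sigma> \<longrightarrow> \<tau> \<in> K) \<and>
     (\<forall>v\<in>V. {v} \<in> K)"

definition polyhedral_product ::
  "'i set \<Rightarrow> 'i set set \<Rightarrow> ('i \<Rightarrow> 'a topology) \<Rightarrow> ('i \<Rightarrow> 'a) \<Rightarrow> ('i \<Rightarrow> 'a) topology" where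
  "polyhedral_product I K X b =
     subtopology (product_topology X I)
       (\<Union>\<sigma>\<in>K. \<Pi>\<^sub>E i\<in>I. if i \<in> \<sigma> then topspace (X i) else {b i})"

text \<open>A subcollection with pairwise distinct indices is given by its index set \<open>J\<close>;
  for empty \<open>J\<close> the product is a point and the equation reads \<open>0 = 0\<close>.\<close>

definition LS_logarithmic :: "'i set \<Rightarrow> ('i \<Rightarrow> 'a topology) \<Rightarrow> bool" where
  "LS_logarithmic I X \<longleftrightarrow>
     (\<forall>J. J \<subseteq> I \<and> finite J \<longrightarrow> lscat (product_topology X J) = (\<Sum>i\<in>J. lscat (X i)))"

end

theory Submission
  imports Defs
begin

text \<open>
  Lower bound: for \<open>\<sigma> \<in> K\<close> the product of the \<open>X i\<close>, \<open>i \<in> \<sigma>\<close>, is a retract of the polyhedral product,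
  and the category does not increase under retracts.

  Upper bound: if \<open>X\<close> is normal and path connected with \<open>cat X \<le> n\<close>, then it has an infinite sequence of
  open sets \<open>V k\<close>, each contractible in \<open>X\<close> and containing the base point, such that every point is
  missed by at most \<open>n\<close> of them. They are cut out by distinct levels \<open>r k\<close> of an increasing sequence of
  functions \<open>0 = s 0 \<le> \<dots> \<le> s (n + 1)\<close> rising only inside the given categorical sets: \<open>V k\<close> is the
  disjoint union of the sets \<open>{s j < r k < s (j + 1)}\<close>. Since the base point is nondegenerate, the
  contractions can be made based. A point of the polyhedral product over \<open>\<sigma>\<close> is missed by at most
  \<open>\<Sum>i\<in>\<sigma>. cat (X i)\<close> of the boxes \<open>\<Prod>i. V i k\<close>, so \<open>N + 1\<close> boxes cover when all these sums are
  at most \<open>N\<close>; and based contractions performed coordinatewise stay inside the polyhedral product.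
\<close>

section \<open>Categorical covers, change of end point, and retracts\<close>

text \<open>An infimum of a nonempty set in \<open>enat\<close> is attained, and the empty set would
  give \<open>\<infinity>\<close>. A cover by fewer sets is padded to the required length by
  repeating its last member.\<close>

lemma lscat_le_iff:
  "lscat X \<le> enat n \<longleftrightarrow>
     (\<exists>U :: nat \<Rightarrow> 'a set. (\<forall>k\<le>n. openin X (U k) \<and> contractible_in X (U k)) \<and>
        (\<Union>k\<le>n. U k) = topspace X)" (is "_ \<longleftrightarrow> ?cover n")
proof
  assume "?cover n"
  then show "lscat X \<le> enat n"
    unfolding lscat_def by (intro Inf_lower) blast
next
  let ?S = "{enat n | n. ?cover n}"
  assume le: "lscat X \<le> enat n"
  have "?S \<noteq> {}"
  proof
    assume "?S = {}"
    then have "lscat X = \<infinity>"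
      unfolding lscat_def Inf_enat_def by simp
    with le show False by simp
  qed
  then have "Inf ?S \<in> ?S"
    using wellorder_InfI[of _ ?S] by blast
  then have "lscat X \<in> ?S"
    by (simp only: lscat_def)
  then obtain k and U :: "nat \<Rightarrow> 'a set" where k: "lscat X = enat k"
    and U: "\<forall>j\<le>k. openin X (U j) \<and> contractible_in X (U j)" "(\<Union>j\<le>k. U j) = topspace X"
    by auto
  have "k \<le> n" using k le by simp
  then have "(\<lambda>j. min j k) ` {..n} = {..k}"
    by (force simp: image_iff min_def)
  then have "(\<Union>j\<le>n. U (min j k)) = (\<Union>j\<le>k. U j)"
    by (metis image_image)
  then show "?cover n"
    using U by (intro exI[of _ "\<lambda>j. U (min j k)"]) simp
qed

text \<open>A path from \<open>a\<close> to \<open>c\<close> joins the two constant maps. All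
  contractions can thus be made to end at one common point, which is what allows them to be
  pasted.\<close>

lemma contractible_inD:
  assumes "contractible_in X U" "path_connected_space X" "c \<in> topspace X"
  shows "homotopic_with (\<lambda>_. True) (subtopology X U) X id (\<lambda>_. c)"
proof -
  obtain a where a: "a \<in> topspace X"
    and hom: "homotopic_with (\<lambda>_. True) (subtopology X U) X id (\<lambda>_. a)"
    using assms(1) unfolding contractible_in_def by blast
  have "path_component_of X a c"
    using assms(2,3) a by (simp add: path_connected_space_iff_path_component)
  then have "homotopic_with (\<lambda>_. True) (subtopology X U) X (\<lambda>_. a) (\<lambda>_. c)"
    by (simp add: homotopic_constant_maps)
  with hom show ?thesis
    by (rule homotopic_with_trans)
qed

text \<open>The cover of \<open>Y\<close> is pulled back along \<open>f\<close>; each contraction is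
  precomposed with \<open>f\<close> and postcomposed with \<open>g\<close>, and
  \<open>g \<circ> f\<close> is the identity.\<close>

lemma lscat_le_retract:
  assumes f: "continuous_map X Y f" and g: "continuous_map Y X g"
    and gf: "\<And>x. x \<in> topspace X \<Longrightarrow> g (f x) = x"
  shows "lscat X \<le> lscat Y"
proof (cases "lscat Y")
  case (enat n)
  then have "lscat Y \<le> enat n" by simp
  then obtain U :: "nat \<Rightarrow> 'b set" where U: "\<forall>k\<le>n. openin Y (U k) \<and> contractible_in Y (U k)"
    "(\<Union>k\<le>n. U k) = topspace Y"
    unfolding lscat_le_iff by blast
  let ?V = "\<lambda>k. {x \<in> topspace X. f x \<in> U k}"
  have "contractible_in X (?V k)" if k: "k \<le> n" for k
  proof -
    obtain a where a: "a \<in> topspace Y"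
      and hom: "homotopic_with (\<lambda>_. True) (subtopology Y (U k)) Y id (\<lambda>_. a)"
      using U(1)[rule_format, OF k] unfolding contractible_in_def by blast
    have "continuous_map (subtopology X (?V k)) (subtopology Y (U k)) f"
      using f by (auto simp: continuous_map_in_subtopology continuous_map_from_subtopology)
    with hom have "homotopic_with (\<lambda>_. True) (subtopology X (?V k)) Y (id \<circ> f) ((\<lambda>_. a) \<circ> f)"
      by (rule homotopic_with_compose_continuous_map_right) simp
    then have "homotopic_with (\<lambda>_. True) (subtopology X (?V k)) X
        (g \<circ> (id \<circ> f)) (g \<circ> ((\<lambda>_. a) \<circ> f))"
      by (rule homotopic_with_compose_continuous_map_left[OF _ g]) simp
    then have "homotopic_with (\<lambda>_. True) (subtopology X (?V k)) X id (\<lambda>_. g a)"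
      by (rule homotopic_with_eq) (auto simp: gf)
    moreover have "g a \<in> topspace X"
      using a g by (auto simp: continuous_map_def)
    ultimately show ?thesis
      unfolding contractible_in_def by blast
  qed
  moreover have "openin X (?V k)" if "k \<le> n" for k
    using U(1) that f by (simp add: openin_continuous_map_preimage)
  moreover have "(\<Union>k\<le>n. ?V k) = topspace X"
    using U(2) f by (fastforce simp: continuous_map_def)
  ultimately show ?thesis
    unfolding enat lscat_le_iff by (intro exI[of _ ?V]) simp
qed simp

section \<open>Infinite families of categorical open sets with few misses\<close>

text \<open>A substitute for a partition of unity subordinate to \<open>U\<close>: the differences \<open>s (Suc j) - s j\<close>
  are supported in \<open>U j\<close> and add up to at least 1 on \<open>C\<close>.\<close>

lemma normal_space_staircase:
  fixes U :: "nat \<Rightarrow> 'a set"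
  assumes X: "normal_space X"
  shows "closedin X C \<Longrightarrow> (\<And>j. j < n \<Longrightarrow> openin X (U j)) \<Longrightarrow> C \<subseteq> (\<Union>j<n. U j) \<Longrightarrow>
    \<exists>s :: nat \<Rightarrow> 'a \<Rightarrow> real. (\<forall>j\<le>n. continuous_map X euclideanreal (s j)) \<and> (\<forall>x. s 0 x = 0) \<and>
      (\<forall>j\<le>n. \<forall>x\<in>topspace X. 0 \<le> s j x) \<and>
      (\<forall>j<n. \<forall>x\<in>topspace X. s j x \<le> s (Suc j) x) \<and>
      (\<forall>j<n. \<forall>x\<in>topspace X. s j x < s (Suc j) x \<longrightarrow> x \<in> U j) \<and>
      (\<forall>x\<in>C. 1 \<le> s n x)"
proof (induction n arbitrary: C)
  case 0
  then show ?case
    by (intro exI[of _ "\<lambda>_ _. 0"]) auto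
next
  case (Suc n)
  let ?V = "\<Union>j<n. U j"
  have "closedin X (C - ?V)"
    using Suc.prems by (intro closedin_diff openin_Union) auto
  moreover have "closedin X (topspace X - U n)"
    using Suc.prems by (intro closedin_diff) auto
  moreover have "disjnt (topspace X - U n) (C - ?V)"
    using Suc.prems(3) by (auto simp: disjnt_def lessThan_Suc)
  ultimately obtain h where h: "continuous_map X (top_of_set {0..1::real}) h"
    "h ` (topspace X - U n) \<subseteq> {0}" "h ` (C - ?V) \<subseteq> {1}"
    using Urysohn_lemma[OF X, of "topspace X - U n" "C - ?V" 0 1] by auto
  have hc: "continuous_map X euclideanreal h" and h01: "\<And>x. x \<in> topspace X \<Longrightarrow> 0 \<le> h x"
    using h(1) by (auto simp: continuous_map_in_subtopology)
  have CX: "C \<subseteq> topspace X" using Suc.prems(1) by (rule closedin_subset)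
  \<comment> \<open>Since \<open>h\<close> is 1 on \<open>C - ?V\<close>, the part of
    \<open>C\<close> with \<open>h \<le> 1/2\<close> lies in \<open>?V\<close> and can be left to
    the induction hypothesis.\<close>
  let ?C = "C \<inter> {x \<in> topspace X. h x \<in> {..1/2}}"
  have "closedin X ?C"
    using Suc.prems(1) hc by (intro closedin_Int closedin_continuous_map_preimage[of X euclideanreal]) auto
  moreover have "?C \<subseteq> ?V"
    using h(3) by fastforce
  ultimately obtain s :: "nat \<Rightarrow> 'a \<Rightarrow> real" where
    "\<forall>j\<le>n. continuous_map X euclideanreal (s j)" "\<forall>x. s 0 x = 0"
    "\<forall>j\<le>n. \<forall>x\<in>topspace X. 0 \<le> s j x"
    "\<forall>j<n. \<forall>x\<in>topspace X. s j x \<le> s (Suc j) x"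
    "\<forall>j<n. \<forall>x\<in>topspace X. s j x < s (Suc j) x \<longrightarrow> x \<in> U j"
    "\<forall>x\<in>?C. 1 \<le> s n x"
    using Suc.IH[of ?C] Suc.prems(2)[OF less_SucI] by blast
  note s = this[rule_format]
  \<comment> \<open>The new step is positive only where \<open>h > 0\<close>, hence inside
    \<open>U n\<close>. The factor 2 makes it at least 1 where \<open>h > 1/2\<close>, the part of
    \<open>C\<close> left out of \<open>?C\<close>.\<close>
  define s' where "s' = (\<lambda>j x. if j \<le> n then s j x else s n x + 2 * h x)"
  have cont: "continuous_map X euclideanreal (s' j)" if "j \<le> Suc n" for j
    unfolding s'_def using s(1) hc
    by (cases "j \<le> n") (auto intro!: continuous_intros)
  have nonneg: "0 \<le> s' j x" if "j \<le> Suc n" "x \<in> topspace X" for j x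
    unfolding s'_def using s(3) h01 that by auto
  have step: "s' j x \<le> s' (Suc j) x" "s' j x < s' (Suc j) x \<longrightarrow> x \<in> U j"
    if "j < Suc n" "x \<in> topspace X" for j x
  proof -
    have "x \<in> U n" if "0 < h x"
      using h(2) that \<open>x \<in> topspace X\<close> by force
    moreover have "j < n \<or> j = n" using that by auto
    ultimately show "s' j x \<le> s' (Suc j) x" "s' j x < s' (Suc j) x \<longrightarrow> x \<in> U j"
      using h01 s(4,5) that by (auto simp: s'_def)
  qed
  have top: "1 \<le> s' (Suc n) x" if "x \<in> C" for x
  proof (cases "h x \<le> 1/2")
    case True
    then show ?thesis using s(6)[of x] that CX h01[of x] by (auto simp: s'_def)
  next
    case False
    then show ?thesis using s(3)[of n x] that CX by (auto simp: s'_def)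
  qed
  have zero: "s' 0 x = 0" for x using s(2) by (simp add: s'_def)
  show ?case
    by (intro exI[of _ s'] conjI allI ballI impI)
      (rule cont nonneg step(1) step(2)[rule_format] top zero; assumption)+
qed

text \<open>The contractions of the pieces can all be given the end point \<open>c\<close>, and over
  disjoint open pieces they paste to a continuous map without any matching condition.\<close>

lemma contractible_in_disjoint_Union:
  assumes X: "path_connected_space X" "c \<in> topspace X"
    and A: "\<And>j. j \<in> J \<Longrightarrow> openin X (A j)" "\<And>j. j \<in> J \<Longrightarrow> contractible_in X (A j)"
    and dis: "\<And>i j x. \<lbrakk>i \<in> J; j \<in> J; x \<in> A i; x \<in> A j\<rbrakk> \<Longrightarrow> i = j"
  shows "contractible_in X (\<Union>j\<in>J. A j)"
proof -
  let ?I = "top_of_set {0..1::real}" and ?A = "\<Union>j\<in>J. A j"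
  have "\<forall>j\<in>J. \<exists>h. continuous_map (prod_topology ?I (subtopology X (A j))) X h \<and>
       (\<forall>x. h(0, x) = x) \<and> (\<forall>x. h(1, x) = c)"
    using contractible_inD[OF A(2) X] unfolding homotopic_with_def by auto
  then obtain h where h: "\<And>j. j \<in> J \<Longrightarrow> continuous_map (prod_topology ?I (subtopology X (A j))) X (h j)"
    "\<And>j x. j \<in> J \<Longrightarrow> h j (0, x) = x" "\<And>j x. j \<in> J \<Longrightarrow> h j (1, x) = c"
    by metis
  have AX: "A j \<subseteq> topspace X" if "j \<in> J" for j
    using A(1)[OF that] by (rule openin_subset)
  \<comment> \<open>This identifies the domain of \<open>h j\<close> with an open piece of the
    cylinder over the whole union, the form in which pasting needs it.\<close>
  have sub: "subtopology (prod_topology ?I (subtopology X ?A)) ({0..1} \<times> A j) =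
      prod_topology ?I (subtopology X (A j))" if "j \<in> J" for j
    using that by (auto simp: subtopology_Times[symmetric] prod_topology_subtopology subtopology_subtopology
        intro!: arg_cong2[where f=subtopology] dest: AX)
  obtain H where H: "continuous_map (prod_topology ?I (subtopology X ?A)) X H"
    "\<And>z j. \<lbrakk>j \<in> J; z \<in> topspace (prod_topology ?I (subtopology X ?A)) \<inter> ({0..1} \<times> A j)\<rbrakk> \<Longrightarrow> H z = h j z"
  proof (rule pasting_lemma_exists[where X="prod_topology ?I (subtopology X ?A)" and I=J
        and T="\<lambda>j. {0..1} \<times> A j" and Y=X and f=h])
    show "openin (prod_topology ?I (subtopology X ?A)) ({0..1} \<times> A j)" if "j \<in> J" for j
      using that A(1) by (auto simp: openin_prod_Times_iff openin_subtopology)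
    show "continuous_map (subtopology (prod_topology ?I (subtopology X ?A)) ({0..1} \<times> A j)) X (h j)"
      if "j \<in> J" for j
      unfolding sub[OF that] by (rule h(1)[OF that])
  qed (use dis in auto)
  have Hh: "H (t, x) = h j (t, x)" if "j \<in> J" "x \<in> A j" "t \<in> {0..1}" for j x t
    using H(2)[OF that(1), of "(t, x)"] that AX by auto
  have "homotopic_with (\<lambda>_. True) (subtopology X ?A) X id (\<lambda>_. c)"
    by (subst homotopic_with) (use H(1) h in \<open>auto intro!: exI[of _ H] simp: Hh\<close>)
  then show ?thesis
    unfolding contractible_in_def using X(2) AX by blast
qed

text \<open>Covering alone is too weak for products: coordinates may lie in sets with different
  indices. A bound on the number of missed sets adds up over coordinates, and an infinite sequence
  allows as many boxes as the sum requires.\<close>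

lemma lscat_general_cover:
  assumes X: "normal_space X" "path_connected_space X" and c: "c \<in> topspace X"
    and n: "lscat X \<le> enat n"
  obtains V :: "nat \<Rightarrow> 'a set" where
    "\<And>k. openin X (V k)" "\<And>k. contractible_in X (V k)" "\<And>k. c \<in> V k"
    "\<And>x. x \<in> topspace X \<Longrightarrow> finite {k. x \<notin> V k} \<and> card {k. x \<notin> V k} \<le> n"
proof -
  obtain U where U: "\<And>k. k \<le> n \<Longrightarrow> openin X (U k)" "\<And>k. k \<le> n \<Longrightarrow> contractible_in X (U k)"
    "(\<Union>k\<le>n. U k) = topspace X"
    using n unfolding lscat_le_iff by blast
  then have U': "\<And>j. j < Suc n \<Longrightarrow> openin X (U j)" "topspace X \<subseteq> (\<Union>j<Suc n. U j)"
    by (auto simp: lessThan_Suc_atMost)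
  obtain s :: "nat \<Rightarrow> 'a \<Rightarrow> real" where
    "\<forall>j\<le>Suc n. continuous_map X euclideanreal (s j)" "\<forall>x. s 0 x = 0"
    "\<forall>j<Suc n. \<forall>x\<in>topspace X. s j x \<le> s (Suc j) x"
    "\<forall>j<Suc n. \<forall>x\<in>topspace X. s j x < s (Suc j) x \<longrightarrow> x \<in> U j"
    "\<forall>x\<in>topspace X. 1 \<le> s (Suc n) x"
    using normal_space_staircase[OF X(1) closedin_topspace U'] by blast
  note s = this[rule_format]
  have mono: "s i x \<le> s j x" if "i \<le> j" "j \<le> Suc n" "x \<in> topspace X" for i j x
    using that(1,2)
  proof (induction rule: dec_induct)
    case (step k)
    then have "s i x \<le> s k x" "s k x \<le> s (Suc k) x"
      using s(3)[of k x] that(3) by auto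
    then show ?case by (rule order_trans)
  qed simp
  \<comment> \<open>Removing the finitely many values \<open>s j c\<close> from the admissible
    levels puts \<open>c\<close> into every \<open>V k\<close>; infinitely many levels
    remain.\<close>
  have "infinite ({0<..<1::real} - (\<lambda>j. s j c) ` {1..n})"
    by (simp add: infinite_Ioo)
  then obtain r :: "nat \<Rightarrow> real" where r: "inj r" "range r \<subseteq> {0<..<1} - (\<lambda>j. s j c) ` {1..n}"
    using infinite_countable_subset by blast
  have r01: "0 < r k" "r k < 1" for k using subsetD[OF r(2) rangeI, of k] by auto
  \<comment> \<open>A point \<open>x\<close> lies in no \<open>A k j\<close> only if \<open>r k\<close> is one of the \<open>n\<close> values \<open>s 1 x, \<dots>, s n x\<close>.\<close>
  define A where "A = (\<lambda>k j. {x \<in> topspace X. s j x < r k} \<inter> {x \<in> topspace X. r k < s (Suc j) x})"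
  define V where "V = (\<lambda>k. \<Union>j\<in>{..n}. A k j)"
  have oA: "openin X (A k j)" if "j \<le> n" for k j
    unfolding A_def
    using openin_continuous_map_preimage[OF s(1)[of j], of "{..<r k}"]
      openin_continuous_map_preimage[OF s(1)[of "Suc j"], of "{r k<..}"] that
    by auto
  have AU: "A k j \<subseteq> U j" if "j \<le> n" for k j
    using s(4)[of j] that by (auto simp: A_def)
  have cA: "contractible_in X (A k j)" if "j \<le> n" for k j
  proof -
    have "subtopology (subtopology X (U j)) (A k j) = subtopology X (A k j)"
      using AU[OF that] by (simp add: subtopology_subtopology Int_absorb1)
    then have "homotopic_with (\<lambda>_. True) (subtopology X (A k j)) X (id \<circ> id) ((\<lambda>_. c) \<circ> id)"
      using contractible_inD[OF U(2)[OF that] X(2) c]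
      by (intro homotopic_with_compose_continuous_map_right[where ?X2.0="subtopology X (U j)"])
        (auto simp: continuous_map_in_subtopology intro: AU[OF that, THEN subsetD])
    then show ?thesis
      using c by (auto simp: contractible_in_def A_def o_def id_def)
  qed
  have disA: "i = j" if "i \<le> n" "j \<le> n" "x \<in> A k i" "x \<in> A k j" for i j k x
  proof (rule ccontr)
    assume "i \<noteq> j"
    then have "Suc i \<le> j \<or> Suc j \<le> i" by auto
    then show False
      using mono[of "Suc i" j x] mono[of "Suc j" i x] that by (auto simp: A_def)
  qed
  have missed: "r k \<in> (\<lambda>j. s j x) ` {1..n}" if x: "x \<in> topspace X" "x \<notin> V k" for k x
  proof -
    \<comment> \<open>The first step above level \<open>r k\<close> exists because
      \<open>s (Suc n) x \<ge> 1 > r k\<close>, and it is not step 0 because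
      \<open>s 0 x = 0 < r k\<close>. Its predecessor \<open>i\<close> has
      \<open>s i x \<le> r k\<close>, where strict inequality would put \<open>x\<close> into
      \<open>A k i\<close>.\<close>
    define j where "j = (LEAST j. r k < s j x)"
    have ex: "r k < s (Suc n) x"
      using s(5)[OF x(1)] r01(2)[of k] by linarith
    have j: "r k < s j x" "j \<le> Suc n"
      unfolding j_def by (rule LeastI, rule ex) (rule Least_le, rule ex)
    have "j \<noteq> 0"
      using j(1) s(2)[of x] r01(1)[of k] by (intro notI) simp
    then obtain i where i: "j = Suc i" by (cases j) auto
    have "s i x \<le> r k"
      using not_less_Least[of i "\<lambda>j. r k < s j x"] i j_def by simp
    moreover have "\<not> s i x < r k"
      using x i j by (auto simp: V_def A_def)
    ultimately have eq: "s i x = r k" by simp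
    moreover have "i \<noteq> 0"
      using eq s(2)[of x] r01(1)[of k] by (intro notI) simp
    ultimately show ?thesis
      using i j(2) by (intro image_eqI[of _ _ i]) auto
  qed
  show thesis
  proof
    show "openin X (V k)" for k
      unfolding V_def using oA by auto
    show "contractible_in X (V k)" for k
      unfolding V_def
      by (rule contractible_in_disjoint_Union[OF X(2) c]) (auto intro: oA cA disA)
    show "c \<in> V k" for k
      using missed[OF c, of k] r(2) by blast
    show "finite {k. x \<notin> V k} \<and> card {k. x \<notin> V k} \<le> n" if x: "x \<in> topspace X" for x
    proof -
      have sub: "r ` {k. x \<notin> V k} \<subseteq> (\<lambda>j. s j x) ` {1..n}"
        using missed[OF x] by blast
      have inj: "inj_on r {k. x \<notin> V k}" using r(1) by (rule inj_on_subset) simp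
      have "card {k. x \<notin> V k} \<le> card ((\<lambda>j. s j x) ` {1..n})"
        by (rule card_inj_on_le[OF inj sub]) simp
      also have "\<dots> \<le> n" using card_image_le[of "{1..n}" "\<lambda>j. s j x"] by simp
      finally show ?thesis
        using inj_on_finite[OF inj sub] by simp
    qed
  qed
qed

section \<open>Based contractions at a nondegenerate point\<close>

text \<open>Used to run a homotopy for a time that depends on the point.\<close>

lemma continuous_map_homotopy_compose:
  assumes h: "continuous_map (prod_topology (top_of_set {0..1::real}) X) Y h"
    and t: "continuous_map Z euclideanreal t" "\<And>z. z \<in> topspace Z \<Longrightarrow> 0 \<le> t z \<and> t z \<le> 1"
    and f: "continuous_map Z X f"
  shows "continuous_map Z Y (\<lambda>z. h (t z, f z))"
proof -
  have "continuous_map Z (prod_topology (top_of_set {0..1}) X) (\<lambda>z. (t z, f z))"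
    using t f by (auto simp: continuous_map_paired continuous_map_in_subtopology)
  then show ?thesis
    using continuous_map_compose[OF _ h] by (simp add: o_def)
qed

text \<open>As \<open>h\<close> fixes \<open>b\<close> at all times, the tube lemma gives a
  neighbourhood \<open>O'\<close> of \<open>b\<close> whose tracks stay in \<open>U\<close>. Taking
  the maximum of \<open>u0\<close> with a Urysohn function equal to 1 off \<open>O'\<close> shrinks
  the region \<open>u < 1\<close> into \<open>O'\<close>.\<close>

lemma nondegenerate_point_within:
  assumes X: "normal_space X" and b: "nondegenerate_point X b" and U: "openin X U" "b \<in> U"
  obtains u :: "'a \<Rightarrow> real" and h :: "real \<times> 'a \<Rightarrow> 'a" where
    "continuous_map X euclideanreal u" "\<And>x. x \<in> topspace X \<Longrightarrow> 0 \<le> u x \<and> u x \<le> 1"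
    "u b = 0" "\<And>x. x \<in> topspace X \<Longrightarrow> u x = 0 \<Longrightarrow> x = b"
    "continuous_map (prod_topology (top_of_set {0..1}) X) X h"
    "\<And>x. x \<in> topspace X \<Longrightarrow> h (0, x) = x" "\<And>t. t \<in> {0..1} \<Longrightarrow> h (t, b) = b"
    "\<And>x. x \<in> topspace X \<Longrightarrow> u x < 1 \<Longrightarrow> h (1, x) = b"
    "\<And>x t. x \<in> topspace X \<Longrightarrow> u x < 1 \<Longrightarrow> t \<in> {0..1} \<Longrightarrow> h (t, x) \<in> U"
proof -
  let ?I = "top_of_set {0..1::real}"
  obtain u0 :: "'a \<Rightarrow> real" and h where u0: "continuous_map X ?I u0"
    "{x \<in> topspace X. u0 x = 0} = {b}"
    and h: "continuous_map (prod_topology ?I X) X h" "\<And>x. x \<in> topspace X \<Longrightarrow> h (0, x) = x"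
    "\<And>t. t \<in> {0..1} \<Longrightarrow> h (t, b) = b" "\<And>x. x \<in> topspace X \<Longrightarrow> u0 x < 1 \<Longrightarrow> h (1, x) = b"
    using b unfolding nondegenerate_point_def by clarsimp
  have u0c: "continuous_map X euclideanreal u0" "\<And>x. x \<in> topspace X \<Longrightarrow> 0 \<le> u0 x \<and> u0 x \<le> 1"
    using u0(1) by (auto simp: continuous_map_in_subtopology)
  have bX: "b \<in> topspace X" using u0(2) by auto
  let ?W = "{z \<in> topspace (prod_topology ?I X). h z \<in> U}"
  have "openin (prod_topology ?I X) ?W"
    using h(1) U(1) by (rule openin_continuous_map_preimage)
  moreover have "compactin ?I {0..1}"
    by (simp add: compactin_subtopology)
  moreover have "{0..1} \<times> {b} \<subseteq> ?W"
    using h(3) U(2) bX by auto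
  ultimately obtain A O' where O': "openin X O'" "b \<in> O'" "{0..1} \<subseteq> A" "A \<times> O' \<subseteq> ?W"
    using tube_lemma_left[of ?I X ?W "{0..1}" b] bX by blast
  \<comment> \<open>\<open>normal_space\<close> does not include the T1 axiom, so closedness of
    \<open>{b}\<close> is read off from its being the zero set of \<open>u0\<close>.\<close>
  have "closedin X {x \<in> topspace X. u0 x \<in> {0}}"
    by (rule closedin_continuous_map_preimage[OF u0c(1)]) simp
  then have "closedin X {b}" using u0(2) by simp
  moreover have "closedin X (topspace X - O')" using O'(1) by blast
  moreover have "disjnt {b} (topspace X - O')" using O'(2) by auto
  ultimately obtain v where v: "continuous_map X ?I v" "v ` {b} \<subseteq> {0::real}"
    "v ` (topspace X - O') \<subseteq> {1}"
    using Urysohn_lemma[OF X, of "{b}" "topspace X - O'" 0 1] by auto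
  have vc: "continuous_map X euclideanreal v" "\<And>x. x \<in> topspace X \<Longrightarrow> 0 \<le> v x \<and> v x \<le> 1"
    using v(1) by (auto simp: continuous_map_in_subtopology)
  let ?u = "\<lambda>x. max (u0 x) (v x)"
  show thesis
  proof
    show "continuous_map X euclideanreal ?u"
      using u0c vc by (intro continuous_intros)
    show "0 \<le> ?u x \<and> ?u x \<le> 1" if "x \<in> topspace X" for x
      using u0c(2)[OF that] vc(2)[OF that] by auto
    show "?u b = 0" using u0(2) v(2) by auto
    show "x = b" if "x \<in> topspace X" "?u x = 0" for x
    proof -
      have "u0 x = 0"
        using that u0c(2)[of x] by auto
      then show ?thesis using u0(2) that by blast
    qed
    show "h (1, x) = b" if "x \<in> topspace X" "?u x < 1" for x
      using h(4) that by simp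
    show "h (t, x) \<in> U" if "x \<in> topspace X" "?u x < 1" "t \<in> {0..1}" for x t
    proof -
      have "x \<in> O'" using that v(3) by force
      then show ?thesis using O'(3,4) that by blast
    qed
  qed (use h in auto)
qed

text \<open>A free contraction may drag \<open>b\<close> along a path to \<open>a\<close>.
  Collapsing a neighbourhood of \<open>b\<close> to \<open>b\<close> beforehand makes all its points
  follow that same path, which can then be retraced.\<close>

lemma contractible_in_based:
  assumes X: "normal_space X" and b: "nondegenerate_point X b" and U: "openin X U" "b \<in> U"
    and cU: "contractible_in X U"
  shows "homotopic_with (\<lambda>f. f b = b) (subtopology X U) X id (\<lambda>_. b)"
proof -
  let ?I = "top_of_set {0..1::real}" and ?U = "subtopology X U"
  have UX: "U \<subseteq> topspace X" using U(1) by (rule openin_subset)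
  then have bX: "b \<in> topspace X" and tU: "topspace ?U = U" using U(2) by auto
  obtain a F where F: "continuous_map (prod_topology ?I ?U) X F"
    "\<And>x. F (0, x) = x" "\<And>x. F (1, x) = a"
    using cU unfolding contractible_in_def homotopic_with_def by auto
  obtain u :: "'a \<Rightarrow> real" and h where
    u: "continuous_map X euclideanreal u" "\<And>x. x \<in> topspace X \<Longrightarrow> 0 \<le> u x \<and> u x \<le> 1"
    "u b = 0" "\<And>x. x \<in> topspace X \<Longrightarrow> u x = 0 \<Longrightarrow> x = b"
    and h: "continuous_map (prod_topology ?I X) X h"
    "\<And>x. x \<in> topspace X \<Longrightarrow> h (0, x) = x" "\<And>t. t \<in> {0..1} \<Longrightarrow> h (t, b) = b"
    "\<And>x. x \<in> topspace X \<Longrightarrow> u x < 1 \<Longrightarrow> h (1, x) = b"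
    "\<And>x t. x \<in> topspace X \<Longrightarrow> u x < 1 \<Longrightarrow> t \<in> {0..1} \<Longrightarrow> h (t, x) \<in> U"
    using nondegenerate_point_within[OF X b U] by blast
  \<comment> \<open>The based contraction moves \<open>x\<close> along \<open>h\<close> up to time \<open>p x\<close>, then along \<open>F\<close> up to time \<open>q x\<close>,
    and finally back along the track \<open>F (_, b)\<close> of the base point. Points with \<open>p x < 1\<close>
    have \<open>q x = 1\<close> and so reach \<open>a = F (1, b)\<close>; the others reach \<open>F (q x, b)\<close>.\<close>
  define p where "p = (\<lambda>x. min 1 (2 * (1 - u x)))"
  define q where "q = (\<lambda>x. min 1 (2 * u x))"
  have p01: "0 \<le> p x \<and> p x \<le> 1" and q01: "0 \<le> q x \<and> q x \<le> 1" if "x \<in> U" for x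
    using u(2)[of x] that UX by (auto simp: p_def q_def)
  have uU: "continuous_map ?U euclideanreal u"
    using u(1) by (rule continuous_map_from_subtopology)
  have pc: "continuous_map ?U euclideanreal p" and qc: "continuous_map ?U euclideanreal q"
    unfolding p_def q_def by (intro continuous_intros uU; simp)+
  have [simp]: "p b = 1" "q b = 0" by (simp_all add: p_def q_def u(3))
  \<comment> \<open>Where \<open>u x < 1\<close> the track stays in \<open>U\<close>; where
    \<open>u x = 1\<close> the time \<open>p x\<close> is 0 and \<open>x\<close> does not move.
    Hence \<open>F\<close> can be applied afterwards.\<close>
  have hU: "h (t * p x, x) \<in> U" if "x \<in> U" "t \<in> {0..1}" for t x
  proof (cases "u x < 1")
    case True
    then show ?thesis using h(5)[of x "t * p x"] p01[OF that(1)] that UX by (auto intro: mult_le_one)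
  next
    case False
    then have "u x = 1" using u(2)[of x] that UX by force
    then show ?thesis using h(2)[of x] that UX by (auto simp: p_def)
  qed
  \<comment> \<open>If \<open>q x < 1\<close> then \<open>u x < 1/2\<close>, so
    \<open>p x = 1\<close> and \<open>h\<close> has already carried \<open>x\<close> to
    \<open>b\<close>.\<close>
  have key: "h (p x, x) = b" if "x \<in> U" "q x < 1" for x
  proof -
    have "p x = 1" "u x < 1" using that by (auto simp: p_def q_def min_def split: if_splits)
    then show ?thesis using h(4)[of x] that UX by auto
  qed
  have T: "continuous_map (prod_topology ?I ?U) euclideanreal fst"
    "continuous_map (prod_topology ?I ?U) ?U snd"
    using continuous_map_fst[of ?I ?U] continuous_map_snd[of ?I ?U]
    by (auto simp: continuous_map_in_subtopology)
  have Tp: "continuous_map (prod_topology ?I ?U) euclideanreal (\<lambda>z. p (snd z))"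
    and Tq: "continuous_map (prod_topology ?I ?U) euclideanreal (\<lambda>z. q (snd z))"
    using continuous_map_compose[OF T(2) pc] continuous_map_compose[OF T(2) qc] by (auto simp: o_def)
  have TX: "continuous_map (prod_topology ?I ?U) X snd"
    using T(2) by (simp add: continuous_map_in_subtopology)
  have H: "continuous_map (prod_topology ?I ?U) X (\<lambda>z. h (fst z * p (snd z), snd z))"
    by (rule continuous_map_homotopy_compose[OF h(1) _ _ TX])
      (auto intro!: continuous_intros T Tp mult_le_one simp: p01 tU)
  have "homotopic_with (\<lambda>f. f b = b) ?U X id (\<lambda>x. h (p x, x))"
    by (subst homotopic_with)
      (use H h(2,3) UX U(2) tU in \<open>auto intro!: exI[of _ "\<lambda>z. h (fst z * p (snd z), snd z)"]\<close>)
  moreover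
  have h1: "continuous_map ?U ?U (\<lambda>x. h (p x, x))"
    using continuous_map_homotopy_compose[OF h(1) pc, of "\<lambda>x. x"] p01 hU[of _ 1]
    by (auto simp: continuous_map_in_subtopology tU)
  have "continuous_map (prod_topology ?I ?U) X (\<lambda>z. F (fst z * q (snd z), h (p (snd z), snd z)))"
    by (rule continuous_map_homotopy_compose[OF F(1)])
      (use continuous_map_compose[OF T(2) h1] in
        \<open>auto intro!: continuous_intros T Tq mult_le_one simp: q01 tU o_def\<close>)
  then have "homotopic_with (\<lambda>f. f b = b) ?U X (\<lambda>x. h (p x, x)) (\<lambda>x. F (q x, h (p x, x)))"
    by (subst homotopic_with)
      (use F(2) h(3) U(2) tU bX in \<open>auto intro!: exI[of _ "\<lambda>z. F (fst z * q (snd z), h (p (snd z), snd z))"]\<close>)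
  moreover
  \<comment> \<open>The starting map agrees with the end of the previous stage: if
    \<open>q x < 1\<close> by \<open>key\<close>, and if \<open>q x = 1\<close> because both values
    are \<open>a\<close>. The final value is \<open>F (0, b) = b\<close>, and \<open>b\<close> stays
    fixed since \<open>q b = 0\<close>.\<close>
  have "continuous_map (prod_topology ?I ?U) X (\<lambda>z. F (q (snd z) * (1 - fst z), b))"
    by (rule continuous_map_homotopy_compose[OF F(1)])
      (use U(2) bX in \<open>auto intro!: continuous_intros T Tq mult_le_one simp: q01 tU o_def\<close>)
  then have "homotopic_with (\<lambda>f. f b = b) ?U X (\<lambda>x. F (q x, h (p x, x))) (\<lambda>_. b)"
  proof (subst homotopic_with, safe intro!: exI[of _ "\<lambda>z. F (q (snd z) * (1 - fst z), b)"])
    fix x assume "x \<in> topspace ?U"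
    then have x: "x \<in> U" by (simp add: tU)
    show "F (q (snd (0, x)) * (1 - fst (0, x)), b) = F (q x, h (p x, x))"
    proof (cases "q x < 1")
      case True
      then show ?thesis using key[OF x] by simp
    next
      case False
      then have "q x = 1" using q01[OF x] by simp
      then show ?thesis by (simp add: F(3))
    qed
  qed (use F(2) U(2) bX in auto)
  ultimately show ?thesis
    by (metis (no_types, lifting) homotopic_with_trans)
qed

section \<open>Retracts and coordinatewise contractions in polyhedral products\<close>

lemma topspace_polyhedral_product:
  assumes "\<And>i. i \<in> I \<Longrightarrow> b i \<in> topspace (X i)"
  shows "topspace (polyhedral_product I K X b) =
    (\<Union>\<sigma>\<in>K. \<Pi>\<^sub>E i\<in>I. if i \<in> \<sigma> then topspace (X i) else {b i})"
proof -
  have "(\<Union>\<sigma>\<in>K. \<Pi>\<^sub>E i\<in>I. if i \<in> \<sigma> then topspace (X i) else {b i})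
      \<subseteq> (\<Pi>\<^sub>E i\<in>I. topspace (X i))"
    using assms by (intro UN_least PiE_mono) auto
  then show ?thesis
    unfolding polyhedral_product_def by (simp add: Int_absorb1)
qed

text \<open>Filling the missing coordinates with base points embeds the product over
  \<open>\<sigma>\<close>, and restriction to \<open>\<sigma>\<close> is a left inverse of this
  embedding.\<close>

lemma lscat_product_le_polyhedral_product:
  assumes \<sigma>: "\<sigma> \<in> K" "\<sigma> \<subseteq> I" and b: "\<And>i. i \<in> I \<Longrightarrow> b i \<in> topspace (X i)"
  shows "lscat (product_topology X \<sigma>) \<le> lscat (polyhedral_product I K X b)"
proof (rule lscat_le_retract)
  let ?f = "\<lambda>x. \<lambda>i\<in>I. if i \<in> \<sigma> then x i else b i"
  have "continuous_map (product_topology X \<sigma>) (product_topology X I) ?f"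
    unfolding continuous_map_componentwise
    using \<sigma>(2) b by (auto intro: continuous_map_product_projection)
  moreover have "?f x \<in> (\<Pi>\<^sub>E i\<in>I. if i \<in> \<sigma> then topspace (X i) else {b i})"
    if "x \<in> topspace (product_topology X \<sigma>)" for x
    using that by auto
  ultimately show "continuous_map (product_topology X \<sigma>) (polyhedral_product I K X b) ?f"
    unfolding polyhedral_product_def continuous_map_in_subtopology using \<sigma>(1) by blast
  have "continuous_map (product_topology X I) (product_topology X \<sigma>) (\<lambda>x. restrict x \<sigma>)"
    unfolding continuous_map_componentwise
    using \<sigma>(2) by (auto intro: continuous_map_product_projection)
  then show "continuous_map (polyhedral_product I K X b) (product_topology X \<sigma>) (\<lambda>x. restrict x \<sigma>)"
    unfolding polyhedral_product_def by (rule continuous_map_from_subtopology)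
  show "restrict (?f x) \<sigma> = x" if "x \<in> topspace (product_topology X \<sigma>)" for x
    using that \<sigma>(2) by (auto simp: fun_eq_iff restrict_def PiE_def extensional_def)
qed

text \<open>\<open>P\<close> holds at every time of the homotopy, so all stages carry
  \<open>S\<close> into \<open>T\<close>, not just the two ends.\<close>

lemma homotopic_with_subtopologies:
  assumes hom: "homotopic_with P X Y f g" and S: "\<And>h. P h \<Longrightarrow> h ` (topspace X \<inter> S) \<subseteq> T"
  shows "homotopic_with (\<lambda>_. True) (subtopology X S) (subtopology Y T) f g"
proof -
  obtain h where h: "continuous_map (prod_topology (top_of_set {0..1::real}) X) Y h"
    "\<forall>x. h (0, x) = f x" "\<forall>x. h (1, x) = g x" "\<forall>t\<in>{0..1}. P (\<lambda>x. h (t, x))"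
    using hom unfolding homotopic_with_def by blast
  have "prod_topology (top_of_set {0..1::real}) (subtopology X S) =
      subtopology (prod_topology (top_of_set {0..1}) X) (UNIV \<times> S)"
    by (simp add: subtopology_Times)
  moreover have "h (t, x) \<in> T" if "t \<in> {0..1}" "x \<in> topspace X \<inter> S" for t x
    using S[of "\<lambda>x. h (t, x)"] h(4) that by blast
  ultimately have "continuous_map (prod_topology (top_of_set {0..1}) (subtopology X S)) (subtopology Y T) h"
    using h(1) by (auto simp: continuous_map_in_subtopology continuous_map_from_subtopology)
  then show ?thesis
    unfolding homotopic_with_def using h by blast
qed

text \<open>The contractions act separately on the coordinates and fix each \<open>b i\<close>. A
  coordinate outside \<open>\<sigma>\<close> therefore stays at its base point, and every stage
  keeps the piece belonging to \<open>\<sigma>\<close> inside itself.\<close>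

lemma contractible_in_polyhedral_product:
  assumes b: "\<And>i. i \<in> I \<Longrightarrow> b i \<in> V i" and V: "\<And>i. i \<in> I \<Longrightarrow> V i \<subseteq> topspace (X i)" and K: "K \<noteq> {}"
    and hom: "\<And>i. i \<in> I \<Longrightarrow>
      homotopic_with (\<lambda>f. f (b i) = b i) (subtopology (X i) (V i)) (X i) id (\<lambda>_. b i)"
  shows "contractible_in (polyhedral_product I K X b)
    (topspace (polyhedral_product I K X b) \<inter> (\<Pi>\<^sub>E i\<in>I. V i))"
proof -
  let ?P = "polyhedral_product I K X b" and ?c = "\<lambda>i\<in>I. b i"
  let ?S = "\<Union>\<sigma>\<in>K. \<Pi>\<^sub>E i\<in>I. if i \<in> \<sigma> then topspace (X i) else {b i}"
  let ?D = "subtopology (product_topology X I) (\<Pi>\<^sub>E i\<in>I. V i)"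
  \<comment> \<open>\<open>?Q\<close> records that a stage is a product of base-point-preserving
    maps; this is what is needed to preserve \<open>?S\<close>.\<close>
  let ?Q = "\<lambda>F. \<exists>h. F = (\<lambda>x. \<lambda>i\<in>I. h i (x i)) \<and>
      (\<forall>i\<in>I. h i ` V i \<subseteq> topspace (X i) \<and> h i (b i) = b i)"
  have bX: "b i \<in> topspace (X i)" if "i \<in> I" for i using b V that by blast
  have tP: "topspace ?P = ?S"
    using bX by (rule topspace_polyhedral_product)
  have "homotopic_with ?Q (product_topology (\<lambda>i. subtopology (X i) (V i)) I) (product_topology X I)
      (\<lambda>z. \<lambda>i\<in>I. id (z i)) (\<lambda>z. \<lambda>i\<in>I. b i)"
  proof (rule homotopic_with_product_topology)
    fix i assume i: "i \<in> I"
    show "homotopic_with (\<lambda>f. f ` V i \<subseteq> topspace (X i) \<and> f (b i) = b i)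
        (subtopology (X i) (V i)) (X i) id (\<lambda>_. b i)"
      using hom[OF i] V[OF i]
      by (elim homotopic_with_mono) (auto simp: continuous_map_def)
  qed blast
  then have "homotopic_with ?Q ?D (product_topology X I) (\<lambda>z. \<lambda>i\<in>I. id (z i)) (\<lambda>z. \<lambda>i\<in>I. b i)"
    by (simp only: subtopology_product_topology)
  moreover have "F ` (topspace ?D \<inter> ?S) \<subseteq> ?S" if "?Q F" for F
  proof -
    obtain h where F: "F = (\<lambda>x. \<lambda>i\<in>I. h i (x i))"
      and h: "\<And>i. i \<in> I \<Longrightarrow> h i ` V i \<subseteq> topspace (X i)" "\<And>i. i \<in> I \<Longrightarrow> h i (b i) = b i"
      using \<open>?Q F\<close> by blast
    show ?thesis
    proof
      fix y assume "y \<in> F ` (topspace ?D \<inter> ?S)"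
      then obtain x \<sigma> where y: "y = F x" and x: "x \<in> topspace ?D" and \<sigma>: "\<sigma> \<in> K"
        "x \<in> (\<Pi>\<^sub>E i\<in>I. if i \<in> \<sigma> then topspace (X i) else {b i})"
        by blast
      have "y \<in> (\<Pi>\<^sub>E i\<in>I. if i \<in> \<sigma> then topspace (X i) else {b i})"
        unfolding y F
      proof (rule restrict_PiE_iff[THEN iffD2], rule ballI)
        fix i assume i: "i \<in> I"
        have "x i \<in> V i" using x i by auto
        moreover have "x i = b i" if "i \<notin> \<sigma>" using \<sigma>(2) i that by (auto dest: PiE_mem)
        ultimately show "h i (x i) \<in> (if i \<in> \<sigma> then topspace (X i) else {b i})"
          using h[OF i] by auto
      qed
      then show "y \<in> ?S" using \<sigma>(1) by blast
    qed
  qed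
  ultimately have "homotopic_with (\<lambda>_. True) (subtopology ?D ?S) ?P
      (\<lambda>z. \<lambda>i\<in>I. id (z i)) (\<lambda>z. \<lambda>i\<in>I. b i)"
    unfolding polyhedral_product_def by (rule homotopic_with_subtopologies)
  moreover have "subtopology ?D ?S = subtopology ?P (topspace ?P \<inter> (\<Pi>\<^sub>E i\<in>I. V i))"
    unfolding tP
    unfolding polyhedral_product_def subtopology_subtopology
    by (rule arg_cong[where f="subtopology _"]) (simp only: Int_ac Int_absorb Int_left_absorb)
  ultimately have "homotopic_with (\<lambda>_. True) (subtopology ?P (topspace ?P \<inter> (\<Pi>\<^sub>E i\<in>I. V i))) ?P
      (\<lambda>z. \<lambda>i\<in>I. id (z i)) (\<lambda>_. ?c)"
    by (simp only:)
  \<comment> \<open>Points of the box are extensional, so restricting them to \<open>I\<close>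
    changes nothing.\<close>
  then have "homotopic_with (\<lambda>_. True) (subtopology ?P (topspace ?P \<inter> (\<Pi>\<^sub>E i\<in>I. V i))) ?P
      id (\<lambda>_. ?c)"
    by (rule homotopic_with_eq) (auto simp: fun_eq_iff PiE_def extensional_def)
  moreover have "?c \<in> topspace ?P"
    unfolding tP using K bX by auto
  ultimately show ?thesis
    unfolding contractible_in_def by blast
qed

section \<open>The upper bound by counting missed boxes, and the equality\<close>

lemma lscat_polyhedral_product_le:
  fixes n :: "'i \<Rightarrow> nat"
  assumes I: "finite I" and K: "K \<noteq> {}" "\<And>\<sigma>. \<sigma> \<in> K \<Longrightarrow> \<sigma> \<subseteq> I"
    and X: "\<And>i. i \<in> I \<Longrightarrow> normal_space (X i)" "\<And>i. i \<in> I \<Longrightarrow> path_connected_space (X i)"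
    and b: "\<And>i. i \<in> I \<Longrightarrow> nondegenerate_point (X i) (b i)"
    and n: "\<And>i. i \<in> I \<Longrightarrow> lscat (X i) \<le> enat (n i)"
    and N: "\<And>\<sigma>. \<sigma> \<in> K \<Longrightarrow> (\<Sum>i\<in>\<sigma>. n i) \<le> N"
  shows "lscat (polyhedral_product I K X b) \<le> enat N"
proof -
  let ?P = "polyhedral_product I K X b"
  have bX: "b i \<in> topspace (X i)" if "i \<in> I" for i
    using b[OF that] by (simp add: nondegenerate_point_def)
  have tP: "topspace ?P =
      (\<Union>\<sigma>\<in>K. \<Pi>\<^sub>E i\<in>I. if i \<in> \<sigma> then topspace (X i) else {b i})"
    using bX by (rule topspace_polyhedral_product)
  have "\<forall>i\<in>I. \<exists>V :: nat \<Rightarrow> 'a set. (\<forall>k. openin (X i) (V k)) \<and> (\<forall>k. contractible_in (X i) (V k)) \<and>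
      (\<forall>k. b i \<in> V k) \<and> (\<forall>x\<in>topspace (X i). finite {k. x \<notin> V k} \<and> card {k. x \<notin> V k} \<le> n i)"
  proof
    fix i assume i: "i \<in> I"
    show "\<exists>V :: nat \<Rightarrow> 'a set. (\<forall>k. openin (X i) (V k)) \<and> (\<forall>k. contractible_in (X i) (V k)) \<and>
      (\<forall>k. b i \<in> V k) \<and> (\<forall>x\<in>topspace (X i). finite {k. x \<notin> V k} \<and> card {k. x \<notin> V k} \<le> n i)"
      by (rule lscat_general_cover[OF X(1)[OF i] X(2)[OF i] bX[OF i] n[OF i]]) blast
  qed
  from bchoice[OF this] obtain V :: "'i \<Rightarrow> nat \<Rightarrow> 'a set" where V:
    "\<And>i k. i \<in> I \<Longrightarrow> openin (X i) (V i k)" "\<And>i k. i \<in> I \<Longrightarrow> contractible_in (X i) (V i k)"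
    "\<And>i k. i \<in> I \<Longrightarrow> b i \<in> V i k"
    "\<And>i x. i \<in> I \<Longrightarrow> x \<in> topspace (X i) \<Longrightarrow> finite {k. x \<notin> V i k}"
    "\<And>i x. i \<in> I \<Longrightarrow> x \<in> topspace (X i) \<Longrightarrow> card {k. x \<notin> V i k} \<le> n i"
    by blast
  define W where "W = (\<lambda>k. topspace ?P \<inter> (\<Pi>\<^sub>E i\<in>I. V i k))"
  have "openin ?P (W k)" for k
  proof -
    have "openin (product_topology X I) (\<Pi>\<^sub>E i\<in>I. V i k)"
      using I V(1) by (simp add: openin_PiE)
    then show ?thesis
      unfolding W_def tP
      unfolding polyhedral_product_def by (rule openin_subtopology_Int2)
  qed
  moreover have "contractible_in ?P (W k)" for k
    unfolding W_def using V(1-3) X(1) b K(1)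
    by (intro contractible_in_polyhedral_product contractible_in_based) (auto dest: openin_subset)
  moreover have "(\<Union>k\<le>N. W k) = topspace ?P"
  proof
    show "(\<Union>k\<le>N. W k) \<subseteq> topspace ?P" by (auto simp: W_def)
    show "topspace ?P \<subseteq> (\<Union>k\<le>N. W k)"
    proof
      fix x assume x: "x \<in> topspace ?P"
      then obtain \<sigma> where \<sigma>: "\<sigma> \<in> K"
        "x \<in> (\<Pi>\<^sub>E i\<in>I. if i \<in> \<sigma> then topspace (X i) else {b i})"
        unfolding tP by blast
      have xb: "x i = b i" if "i \<in> I" "i \<notin> \<sigma>" for i
        using PiE_mem[OF \<sigma>(2) that(1)] that(2) by simp
      have xX: "x i \<in> topspace (X i)" if "i \<in> \<sigma>" for i
        using PiE_mem[OF \<sigma>(2), of i] that K(2)[OF \<sigma>(1)] by auto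
      have \<sigma>I: "\<sigma> \<subseteq> I" and fin: "finite \<sigma>"
        using K(2)[OF \<sigma>(1)] I by (auto intro: finite_subset)
      \<comment> \<open>\<open>?B\<close> contains every index of a box that misses
        \<open>x\<close>: outside \<open>\<sigma>\<close> the coordinate is \<open>b i\<close>,
        which lies in every \<open>V i k\<close>. With at most \<open>N\<close> bad indices, one of
        the \<open>N + 1\<close> indices \<open>0, ..., N\<close> is good.\<close>
      let ?B = "\<Union>i\<in>\<sigma>. {k. x i \<notin> V i k}"
      have "card ?B \<le> (\<Sum>i\<in>\<sigma>. card {k. x i \<notin> V i k})"
        by (rule card_UN_le[OF fin])
      also have "\<dots> \<le> (\<Sum>i\<in>\<sigma>. n i)"
        using V(5) xX \<sigma>I by (intro sum_mono) blast
      also have "\<dots> \<le> N" by (rule N[OF \<sigma>(1)])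
      finally have "card ?B < card {..N}" by simp
      moreover have "finite ?B" using fin V(4) xX \<sigma>I by blast
      ultimately have "\<not> {..N} \<subseteq> ?B"
        using card_mono leD by blast
      then obtain k where k: "k \<le> N" "\<And>i. i \<in> \<sigma> \<Longrightarrow> x i \<in> V i k" by auto
      have "x i \<in> V i k" if "i \<in> I" for i
        using that k(2) xb V(3) by (cases "i \<in> \<sigma>") auto
      then have "x \<in> W k"
        using x \<sigma>(2) by (auto simp: W_def PiE_def)
      with k(1) show "x \<in> (\<Union>k\<le>N. W k)" by blast
    qed
  qed
  ultimately show ?thesis
    unfolding lscat_le_iff by blast
qed

theorem theorem1p5:
  fixes m :: nat
    and X :: "nat \<Rightarrow> 'a topology"
    and b :: "nat \<Rightarrow> 'a"
    and K :: "nat set set"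
  assumes normal: "\<And>i. i \<in> {1..m} \<Longrightarrow> normal_space (X i)"
    and connected: "\<And>i. i \<in> {1..m} \<Longrightarrow> path_connected_space (X i)"
    and based: "\<And>i. i \<in> {1..m} \<Longrightarrow> b i \<in> topspace (X i)"
    and nondegenerate: "\<And>i. i \<in> {1..m} \<Longrightarrow> nondegenerate_point (X i) (b i)"
    and complex: "simplicial_complex_on {1..m} K"
    and logarithmic: "LS_logarithmic {1..m} X"
  shows "lscat (polyhedral_product {1..m} K X b) =
           Max ((\<lambda>\<sigma>. \<Sum>i\<in>\<sigma>. lscat (X i)) ` K)"
proof (rule antisym)
  let ?P = "polyhedral_product {1..m} K X b" and ?s = "\<lambda>\<sigma>. \<Sum>i\<in>\<sigma>. lscat (X i)"
  have K: "{} \<in> K" "\<And>\<sigma>. \<sigma> \<in> K \<Longrightarrow> \<sigma> \<subseteq> {1..m}" "\<And>i. i \<in> {1..m} \<Longrightarrow> {i} \<in> K"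
    using complex by (auto simp: simplicial_complex_on_def)
  have "K \<subseteq> Pow {1..m}" using K(2) by blast
  then have fin: "finite (?s ` K)" by (simp add: finite_subset)
  show "Max (?s ` K) \<le> lscat ?P"
  proof (rule Max.boundedI[OF fin])
    fix c assume "c \<in> ?s ` K"
    then obtain \<sigma> where \<sigma>: "\<sigma> \<in> K" "c = ?s \<sigma>" by blast
    \<comment> \<open>The logarithmic hypothesis turns the sum into the category of a product, which
      is a retract of \<open>?P\<close>.\<close>
    then have "c = lscat (product_topology X \<sigma>)"
      using logarithmic K(2)[OF \<sigma>(1)] finite_subset[of \<sigma> "{1..m}"] by (simp add: LS_logarithmic_def)
    also have "\<dots> \<le> lscat ?P"
      using \<sigma>(1) K(2) based by (intro lscat_product_le_polyhedral_product) auto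
    finally show "c \<le> lscat ?P" .
  qed (use K(1) in auto)
  show "lscat ?P \<le> Max (?s ` K)"
  proof (cases "Max (?s ` K)")
    case (enat N)
    have le: "?s \<sigma> \<le> enat N" if "\<sigma> \<in> K" for \<sigma>
      using Max_ge[OF fin, of "?s \<sigma>"] that enat by simp
    \<comment> \<open>Every vertex is a simplex, so a finite maximum bounds each single
      category.\<close>
    have "\<exists>n. lscat (X i) = enat n" if "i \<in> {1..m}" for i
      using le[OF K(3)[OF that]] by (cases "lscat (X i)") auto
    then obtain n where n: "\<And>i. i \<in> {1..m} \<Longrightarrow> lscat (X i) = enat (n i)" by metis
    have "(\<Sum>i\<in>\<sigma>. n i) \<le> N" if "\<sigma> \<in> K" for \<sigma>
    proof -
      have "?s \<sigma> = (\<Sum>i\<in>\<sigma>. enat (n i))"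
        using n K(2)[OF that] by (intro sum.cong) auto
      also have "\<dots> = enat (\<Sum>i\<in>\<sigma>. n i)"
        by (simp add: of_nat_eq_enat[symmetric])
      finally show ?thesis using le[OF that] by simp
    qed
    then show ?thesis
      unfolding enat
      by (intro lscat_polyhedral_product_le[where n=n])
        (use K normal connected nondegenerate n in auto)
  qed simp
qed

end
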